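(* Let $G$ be a group and let $A\subseteq G$ be of minimal type. Then any minimal closed $G$-invariant subset $Z$ of $X_A$ is a universal minimal $G$-space of type $A$.
   Context: $G$ is a discrete group with neutral element $e$. A locally compact $G$-space is a locally compact Hausdorff space with an action of $G$ by homeomorphisms. It is minimal if it is non-empty and every orbit is dense; it is co-compact if there is a compact $K\subseteq X$ with $\bigcup_{g\in G}g.K=X$ (minimal locally compact $G$-spaces are co-compact). A minimal closed $G$-invariant subset is a non-empty closed $G$-invariant subset containing no proper non-empty closed $G$-invariant subset. A $G$-map is a $G$-equivariant map; a continuous map is proper if preimages of compact sets are compact. A pointed locally compact $G$-space is a pair $(X,x_0)$ with $x_0\in X$ such that $G.x_0$ is dense in $X$. $\beta G$ is the Stone–Čech compactification of the discrete space $G$, with the $G$-action extending left multiplication. For $B\subseteq G$, $K_B$ is the closure of $B$ in $\beta G$, and for non-empty $A \subseteq G$, $X_A=\bigcup_{g\in G}K_{gA}$, an open $G$-invariant subset of $\beta G$. For non-empty $A,B\subseteq G$ write $A\propto B$ if $A\subseteq FB$ for some finite $F\subseteq G$, and $A\approx B$ if $A\propto B$ and $B\propto A$; $[A]$ is the $\approx$-class of $A$. Type: for a pointed locally compact $G$-space $(X,x_0)$ put $\mathcal M(G,X,x_0)=\{B\subseteq G:\overline{B.x_0}\text{ is compact}\}$, and $\mathcal M_A=\{B\subseteq G: B\subseteq FA\text{ for some finite }F\subseteq G\}$. If $X$ is co-compact, there is a non-empty $A\subseteq G$, unique up to $\approx$, with $\mathcal M(G,X,x_0)=\mathcal M_A$,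 and $\mathrm{T}(G,X,x_0)=[A]$. A non-empty subset $A\subseteq G$ is of minimal type if $\mathrm{T}(G,X,x_0)=[A]$ for some pointed minimal locally compact $G$-space $(X,x_0)$. For $A$ of minimal type, a minimal locally compact $G$-space $Z$ is a universal minimal $G$-space of type $A$ if for each pointed minimal locally compact $G$-space $(X,x_0)$ with $\mathrm{T}(G,X,x_0)=[A]$ there is a surjective proper continuous $G$-map $\varphi\colon Z\to X$. *)

theory Defs
  imports "HOL-Analysis.Analysis" "HOL-Algebra.Group_Action"
begin

section \<open>Locally compact G-spaces\<close>

text \<open>
  The group \<open>G\<close> is discrete, so a continuous action is an action by homeomorphisms.  In
  \<^const>\<open>group_action\<close> each \<open>\<phi> g\<close> is a bijection of the space that is \<^const>\<open>undefined\<close> outside of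
  it; this convention carries no mathematical content.
\<close>

definition lc_gspace :: "('g, 'm) monoid_scheme \<Rightarrow> 'x topology \<Rightarrow> ('g \<Rightarrow> 'x \<Rightarrow> 'x) \<Rightarrow> bool" where
  "lc_gspace G X \<phi> \<longleftrightarrow>
     group_action G (topspace X) \<phi> \<and> (\<forall>g\<in>carrier G. homeomorphic_map X X (\<phi> g)) \<and>
     locally_compact_space X \<and> Hausdorff_space X"

definition minimal_lc_gspace :: "('g, 'm) monoid_scheme \<Rightarrow> 'x topology \<Rightarrow> ('g \<Rightarrow> 'x \<Rightarrow> 'x) \<Rightarrow> bool" where
  "minimal_lc_gspace G X \<phi> \<longleftrightarrow>
     lc_gspace G X \<phi> \<and> topspace X \<noteq> {} \<and>
     (\<forall>x\<in>topspace X. X closure_of (orbit G \<phi> x) = topspace X)"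

definition pointed_lc_gspace ::
    "('g, 'm) monoid_scheme \<Rightarrow> 'x topology \<Rightarrow> ('g \<Rightarrow> 'x \<Rightarrow> 'x) \<Rightarrow> 'x \<Rightarrow> bool" where
  "pointed_lc_gspace G X \<phi> x0 \<longleftrightarrow>
     lc_gspace G X \<phi> \<and> x0 \<in> topspace X \<and> X closure_of (orbit G \<phi> x0) = topspace X"

definition cocompact_gspace :: "('g, 'm) monoid_scheme \<Rightarrow> 'x topology \<Rightarrow> ('g \<Rightarrow> 'x \<Rightarrow> 'x) \<Rightarrow> bool" where
  "cocompact_gspace G X \<phi> \<longleftrightarrow>
     (\<exists>K. compactin X K \<and> (\<Union>g\<in>carrier G. \<phi> g ` K) = topspace X)"

definition invariant_set :: "('g, 'm) monoid_scheme \<Rightarrow> ('g \<Rightarrow> 'x \<Rightarrow> 'x) \<Rightarrow> 'x set \<Rightarrow> bool" where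
  "invariant_set G \<phi> Z \<longleftrightarrow> (\<forall>g\<in>carrier G. \<phi> g ` Z \<subseteq> Z)"

definition minimal_closed_invariant ::
    "('g, 'm) monoid_scheme \<Rightarrow> 'x topology \<Rightarrow> ('g \<Rightarrow> 'x \<Rightarrow> 'x) \<Rightarrow> 'x set \<Rightarrow> bool" where
  "minimal_closed_invariant G X \<phi> Z \<longleftrightarrow>
     closedin X Z \<and> Z \<noteq> {} \<and> invariant_set G \<phi> Z \<and>
     \<not> (\<exists>Y. Y \<subset> Z \<and> Y \<noteq> {} \<and> closedin X Y \<and> invariant_set G \<phi> Y)"

definition restrict_action :: "('g \<Rightarrow> 'x \<Rightarrow> 'x) \<Rightarrow> 'x set \<Rightarrow> 'g \<Rightarrow> 'x \<Rightarrow> 'x" where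
  "restrict_action \<phi> Z g = restrict (\<phi> g) Z"

definition proper_gmap ::
    "('g, 'm) monoid_scheme \<Rightarrow> 'x topology \<Rightarrow> ('g \<Rightarrow> 'x \<Rightarrow> 'x) \<Rightarrow> 'y topology \<Rightarrow> ('g \<Rightarrow> 'y \<Rightarrow> 'y) \<Rightarrow>
     ('x \<Rightarrow> 'y) \<Rightarrow> bool" where
  "proper_gmap G X \<phi> Y \<psi> f \<longleftrightarrow>
     continuous_map X Y f \<and>
     (\<forall>g\<in>carrier G. \<forall>x\<in>topspace X. f (\<phi> g x) = \<psi> g (f x)) \<and>
     (\<forall>K. compactin Y K \<longrightarrow> compactin X {x \<in> topspace X. f x \<in> K})"


section \<open>The type of a pointed G-space\<close>

definition covered_by :: "('g, 'm) monoid_scheme \<Rightarrow> 'g set \<Rightarrow> 'g set \<Rightarrow> bool" where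
  "covered_by G A B \<longleftrightarrow> (\<exists>F. finite F \<and> F \<subseteq> carrier G \<and> A \<subseteq> F <#>\<^bsub>G\<^esub> B)"

definition set_equiv :: "('g, 'm) monoid_scheme \<Rightarrow> 'g set \<Rightarrow> 'g set \<Rightarrow> bool" where
  "set_equiv G A B \<longleftrightarrow> covered_by G A B \<and> covered_by G B A"

definition set_class :: "('g, 'm) monoid_scheme \<Rightarrow> 'g set \<Rightarrow> 'g set set" where
  "set_class G A = {B. B \<subseteq> carrier G \<and> B \<noteq> {} \<and> set_equiv G A B}"

definition bounded_family :: "('g, 'm) monoid_scheme \<Rightarrow> 'g set \<Rightarrow> 'g set set" where
  "bounded_family G A = {B. B \<subseteq> carrier G \<and> covered_by G B A}"

definition relcompact_family ::
    "('g, 'm) monoid_scheme \<Rightarrow> 'x topology \<Rightarrow> ('g \<Rightarrow> 'x \<Rightarrow> 'x) \<Rightarrow> 'x \<Rightarrow> 'g set set" where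
  "relcompact_family G X \<phi> x0 =
     {B. B \<subseteq> carrier G \<and> compactin X (X closure_of ((\<lambda>g. \<phi> g x0) ` B))}"

text \<open>
  Meaningful for co-compact pointed spaces: see \<open>gspace_type_exists\<close> and \<open>gspace_type_eqI\<close> below.
\<close>

definition gspace_type ::
    "('g, 'm) monoid_scheme \<Rightarrow> 'x topology \<Rightarrow> ('g \<Rightarrow> 'x \<Rightarrow> 'x) \<Rightarrow> 'x \<Rightarrow> 'g set set" where
  "gspace_type G X \<phi> x0 =
     (THE C. \<exists>A. A \<subseteq> carrier G \<and> A \<noteq> {} \<and>
        relcompact_family G X \<phi> x0 = bounded_family G A \<and> C = set_class G A)"

lemma covered_by_refl:
  assumes "group G" "A \<subseteq> carrier G"
  shows "covered_by G A A"
proof -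
  interpret group G by fact
  have "A \<subseteq> {\<one>\<^bsub>G\<^esub>} <#>\<^bsub>G\<^esub> A"
    using assms(2) by (force simp: set_mult_def)
  then show ?thesis
    unfolding covered_by_def by (intro exI[of _ "{\<one>\<^bsub>G\<^esub>}"]) auto
qed

lemma covered_by_trans:
  assumes "group G" "C \<subseteq> carrier G" "covered_by G A B" "covered_by G B C"
  shows "covered_by G A C"
proof -
  interpret group G by fact
  obtain E F where E: "finite E" "E \<subseteq> carrier G" "A \<subseteq> E <#>\<^bsub>G\<^esub> B"
    and F: "finite F" "F \<subseteq> carrier G" "B \<subseteq> F <#>\<^bsub>G\<^esub> C"
    using assms unfolding covered_by_def by blast
  have "E <#>\<^bsub>G\<^esub> B \<subseteq> E <#>\<^bsub>G\<^esub> (F <#>\<^bsub>G\<^esub> C)"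
    using F(3) by (intro mono_set_mult order_refl)
  then have "A \<subseteq> (E <#>\<^bsub>G\<^esub> F) <#>\<^bsub>G\<^esub> C"
    using E F assms(2) by (simp add: set_mult_assoc)
  moreover have "finite (E <#>\<^bsub>G\<^esub> F)"
    using E F by (simp add: set_mult_def)
  ultimately show ?thesis
    unfolding covered_by_def using set_mult_closed E F by metis
qed

lemma gspace_type_eqI:
  assumes "group G" "A \<subseteq> carrier G" "A \<noteq> {}" "relcompact_family G X \<phi> x0 = bounded_family G A"
  shows "gspace_type G X \<phi> x0 = set_class G A"
  unfolding gspace_type_def
proof (rule the_equality)
  fix C
  assume "\<exists>B. B \<subseteq> carrier G \<and> B \<noteq> {} \<and> relcompact_family G X \<phi> x0 = bounded_family G B \<and> C = set_class G B"
  then obtain B where B: "B \<subseteq> carrier G" "bounded_family G A = bounded_family G B" "C = set_class G B"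
    using assms(4) by auto
  have "covered_by G A B" "covered_by G B A"
    using B assms covered_by_refl[OF assms(1)] unfolding bounded_family_def by blast+
  then show "C = set_class G A"
    using covered_by_trans[OF assms(1)] assms(2) B(1,3)
    unfolding set_class_def set_equiv_def by blast
qed (use assms in blast)

lemma minimal_lc_gspace_cocompact:
  assumes "minimal_lc_gspace G X \<phi>"
  shows "cocompact_gspace G X \<phi>"
proof -
  have lc: "lc_gspace G X \<phi>" using assms by (simp add: minimal_lc_gspace_def)
  then interpret group_action G "topspace X" \<phi> by (simp add: lc_gspace_def)
  obtain x where "x \<in> topspace X" using assms unfolding minimal_lc_gspace_def by blast
  then obtain U K where UK: "openin X U" "compactin X K" "x \<in> U" "U \<subseteq> K"
    using lc unfolding lc_gspace_def locally_compact_space_def by metis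
  have "\<exists>g\<in>carrier G. y \<in> \<phi> g ` K" if y: "y \<in> topspace X" for y
  proof -
    have "x \<in> X closure_of (orbit G \<phi> y)"
      using assms y \<open>x \<in> topspace X\<close> by (auto simp: minimal_lc_gspace_def)
    then obtain g where g: "g \<in> carrier G" "\<phi> g y \<in> U"
      using UK(1,3) unfolding closure_of_def orbit_def by blast
    then have "\<phi> (inv\<^bsub>G\<^esub> g) (\<phi> g y) = y"
      using orbit_sym_aux[OF g(1) y] by simp
    moreover have "inv\<^bsub>G\<^esub> g \<in> carrier G"
      using g(1) group_hom group_hom_def group.inv_closed by metis
    ultimately show ?thesis
      using g(2) UK(4) by (metis image_eqI subsetD)
  qed
  moreover have "\<phi> g ` K \<subseteq> topspace X" if "g \<in> carrier G" for g
    using surj_prop[OF that] compactin_subset_topspace[OF UK(2)] by blast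
  ultimately show ?thesis
    unfolding cocompact_gspace_def using UK(2) by blast
qed

lemma gspace_type_exists:
  assumes "pointed_lc_gspace G X \<phi> x0" "cocompact_gspace G X \<phi>"
  obtains A where "A \<subseteq> carrier G" "A \<noteq> {}" "relcompact_family G X \<phi> x0 = bounded_family G A"
proof -
  have lc: "lc_gspace G X \<phi>" and x0: "x0 \<in> topspace X"
    and dense: "X closure_of (orbit G \<phi> x0) = topspace X"
    using assms(1) by (auto simp: pointed_lc_gspace_def)
  have homeo: "homeomorphic_map X X (\<phi> g)" if "g \<in> carrier G" for g
    using lc that by (simp add: lc_gspace_def)
  have Haus: "Hausdorff_space X" using lc by (simp add: lc_gspace_def)
  interpret group_action G "topspace X" \<phi> using lc by (simp add: lc_gspace_def)
  interpret G: group G using group_hom by (simp add: group_hom_def)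
  obtain K where K: "compactin X K" "(\<Union>g\<in>carrier G. \<phi> g ` K) = topspace X"
    using assms(2) by (auto simp: cocompact_gspace_def)
  have "\<forall>x\<in>K. \<exists>U C. openin X U \<and> compactin X C \<and> x \<in> U \<and> U \<subseteq> C"
    using lc compactin_subset_topspace[OF K(1)] unfolding lc_gspace_def locally_compact_space_def by blast
  then obtain U C where UC: "\<And>x. x \<in> K \<Longrightarrow> openin X (U x) \<and> compactin X (C x) \<and> x \<in> U x \<and> U x \<subseteq> C x"
    by metis
  obtain \<F> where \<F>: "finite \<F>" "\<F> \<subseteq> U ` K" "K \<subseteq> \<Union>\<F>"
  proof -
    have "\<forall>W\<in>U ` K. openin X W" "K \<subseteq> \<Union>(U ` K)" using UC by auto
    then show ?thesis using K(1) that unfolding compactin_def by meson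
  qed
  then obtain T where T: "finite T" "T \<subseteq> K" "\<F> = U ` T"
    by (meson finite_subset_image)
  define V where "V = (\<Union>x\<in>T. U x)"
  define D where "D = (\<Union>x\<in>T. C x)"
  have V: "openin X V" "K \<subseteq> V" "V \<subseteq> D" and D: "compactin X D"
    unfolding V_def D_def using UC T \<F>
    by (auto intro!: compactin_Union)
  define A where "A = {g \<in> carrier G. \<phi> g x0 \<in> V}"
  have inv: "\<phi> (inv\<^bsub>G\<^esub> g) (\<phi> g y) = y" "\<phi> g (\<phi> (inv\<^bsub>G\<^esub> g) y) = y"
    if "g \<in> carrier G" "y \<in> topspace X" for g y
    using that orbit_sym_aux[of g y] orbit_sym_aux[of "inv\<^bsub>G\<^esub> g" y] by auto
  have "A \<noteq> {}"
  proof -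
    have "K \<noteq> {}" using K(2) x0 by auto
    then obtain y where "y \<in> V" using V by blast
    moreover have "y \<in> X closure_of (orbit G \<phi> x0)"
      using \<open>y \<in> V\<close> V(1) dense openin_subset by blast
    ultimately obtain g where "g \<in> carrier G" "\<phi> g x0 \<in> V"
      using V(1) unfolding closure_of_def orbit_def by blast
    then show ?thesis by (auto simp: A_def)
  qed
  have sub: "compactin X (X closure_of S)" if "S \<subseteq> L" "compactin X L" for S L
    using that Haus compactin_imp_closedin closure_of_minimal closed_compactin closedin_closure_of
    by metis
  have "B \<in> relcompact_family G X \<phi> x0" if B: "B \<in> bounded_family G A" for B
  proof -
    obtain F where F: "finite F" "F \<subseteq> carrier G" "B \<subseteq> F <#>\<^bsub>G\<^esub> A"
      using B unfolding bounded_family_def covered_by_def by blast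
    have "(\<lambda>g. \<phi> g x0) ` B \<subseteq> (\<Union>f\<in>F. \<phi> f ` D)"
    proof clarify
      fix b assume "b \<in> B"
      then obtain f a where fa: "f \<in> F" "a \<in> A" "b = f \<otimes>\<^bsub>G\<^esub> a"
        using F(3) unfolding set_mult_def by blast
      then have "\<phi> b x0 = \<phi> f (\<phi> a x0)"
        using composition_rule[OF x0] F(2) by (auto simp: A_def)
      then show "\<phi> b x0 \<in> (\<Union>f\<in>F. \<phi> f ` D)"
        using fa V(3) by (auto simp: A_def)
    qed
    moreover have "compactin X (\<Union>f\<in>F. \<phi> f ` D)"
    proof -
      have "compactin X (\<phi> f ` D)" if "f \<in> F" for f
        using homeo[of f] that F(2) image_compactin[OF D] homeomorphic_imp_continuous_map by blast
      then show ?thesis using F(1) by (auto intro!: compactin_Union)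
    qed
    ultimately show ?thesis
      using sub B by (simp add: relcompact_family_def bounded_family_def)
  qed
  moreover have "B \<in> bounded_family G A" if B: "B \<in> relcompact_family G X \<phi> x0" for B
  proof -
    define L where "L = X closure_of ((\<lambda>g. \<phi> g x0) ` B)"
    have L: "compactin X L" "B \<subseteq> carrier G"
      using B by (auto simp: relcompact_family_def L_def)
    have op: "openin X (\<phi> g ` V)" if "g \<in> carrier G" for g
      using homeo[OF that] V(1) by (meson homeomorphic_map_openness_eq)
    have cov: "L \<subseteq> \<Union>((\<lambda>g. \<phi> g ` V) ` carrier G)"
    proof
      fix y assume "y \<in> L"
      then have "y \<in> (\<Union>g\<in>carrier G. \<phi> g ` K)"
        using K(2) compactin_subset_topspace[OF L(1)] by auto
      then show "y \<in> \<Union>((\<lambda>g. \<phi> g ` V) ` carrier G)"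
        using V(2) by auto
    qed
    obtain \<G> where \<G>: "finite \<G>" "\<G> \<subseteq> (\<lambda>g. \<phi> g ` V) ` carrier G" "L \<subseteq> \<Union>\<G>"
    proof -
      have "\<exists>\<F>. finite \<F> \<and> \<F> \<subseteq> \<U> \<and> L \<subseteq> \<Union>\<F>" if "\<forall>W\<in>\<U>. openin X W" "L \<subseteq> \<Union>\<U>" for \<U>
        using L(1) that unfolding compactin_def by blast
      from this[of "(\<lambda>g. \<phi> g ` V) ` carrier G"] show thesis
        using that op cov by blast
    qed
    then obtain F where F: "finite F" "F \<subseteq> carrier G" "\<G> = (\<lambda>g. \<phi> g ` V) ` F"
      by (meson finite_subset_image)
    have "B \<subseteq> F <#>\<^bsub>G\<^esub> A"
    proof
      fix b assume b: "b \<in> B"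
      have bc: "b \<in> carrier G" using b L(2) by blast
      have top: "\<phi> b x0 \<in> topspace X" using element_image[OF bc x0] by simp
      have "(\<lambda>g. \<phi> g x0) ` B \<subseteq> L"
        unfolding L_def
        using L(2) element_image[OF _ x0] by (intro closure_of_subset) blast
      then obtain f v where f: "f \<in> F" "v \<in> V" "\<phi> b x0 = \<phi> f v"
        using b \<G>(3) F(3) by blast
      have fc: "f \<in> carrier G" using f F(2) by blast
      have "v \<in> topspace X" using f(2) V(1) openin_subset by blast
      then have "\<phi> (inv\<^bsub>G\<^esub> f) (\<phi> b x0) = v"
        using inv(1)[OF fc] f(3) by simp
      then have "inv\<^bsub>G\<^esub> f \<otimes>\<^bsub>G\<^esub> b \<in> A"
        using composition_rule[OF x0] fc bc f(2) by (simp add: A_def)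
      moreover have "b = f \<otimes>\<^bsub>G\<^esub> (inv\<^bsub>G\<^esub> f \<otimes>\<^bsub>G\<^esub> b)"
        using fc bc by (simp add: G.m_assoc[symmetric])
      ultimately show "b \<in> F <#>\<^bsub>G\<^esub> A"
        using f(1) unfolding set_mult_def by blast
    qed
    then show ?thesis
      using F L(2) by (auto simp: bounded_family_def covered_by_def)
  qed
  ultimately have "relcompact_family G X \<phi> x0 = bounded_family G A"
    by blast
  then show ?thesis
    using that[of A] \<open>A \<noteq> {}\<close> unfolding A_def by blast
qed


section \<open>Universal minimal G-spaces\<close>

text \<open>
  HOL cannot quantify over types inside a formula, so the following two notions take as a parameter
  the type \<open>'x\<close> in which the points of the spaces \<open>X\<close> live.  ``Some space'' and ``every space'' are
  obtained from theorems in which that type is a free type variable, occurring nowhere else, in a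
  hypothesis and in a conclusion, respectively.
\<close>

definition minimal_type :: "'x itself \<Rightarrow> ('g, 'm) monoid_scheme \<Rightarrow> 'g set \<Rightarrow> bool" where
  "minimal_type _ G A \<longleftrightarrow>
     A \<subseteq> carrier G \<and> A \<noteq> {} \<and>
     (\<exists>(X :: 'x topology) \<phi> x0.
        minimal_lc_gspace G X \<phi> \<and> pointed_lc_gspace G X \<phi> x0 \<and>
        gspace_type G X \<phi> x0 = set_class G A)"

definition universal_minimal_gspace ::
    "'x itself \<Rightarrow> ('g, 'm) monoid_scheme \<Rightarrow> 'g set \<Rightarrow> 'z topology \<Rightarrow> ('g \<Rightarrow> 'z \<Rightarrow> 'z) \<Rightarrow> bool" where
  "universal_minimal_gspace _ G A Z \<psi> \<longleftrightarrow>
     minimal_lc_gspace G Z \<psi> \<and>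
     (\<forall>(X :: 'x topology) \<phi> x0.
        minimal_lc_gspace G X \<phi> \<and> pointed_lc_gspace G X \<phi> x0 \<and>
        gspace_type G X \<phi> x0 = set_class G A \<longrightarrow>
        (\<exists>f. proper_gmap G Z \<psi> X \<phi> f \<and> f ` topspace Z = topspace X))"


section \<open>The Stone-Cech compactification of a discrete group\<close>

text \<open>
  The Stone-Cech compactification of a discrete set \<open>S\<close> is modelled by the ultrafilters on \<open>S\<close>,
  an element \<open>s\<close> of \<open>S\<close> being identified with the principal ultrafilter \<open>principal {s}\<close>.  An
  ultrafilter on \<open>S\<close> is represented by a filter on the ambient type which contains \<open>S\<close>.  That
  this is the Stone-Cech compactification is proved below: it is a compact Hausdorff space in which
  \<open>S\<close> is dense and discrete, and every map from \<open>S\<close> to a compact Hausdorff space extends to it.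
\<close>

definition ultrafilters_on :: "'a set \<Rightarrow> 'a filter set" where
  "ultrafilters_on S =
     {U. U \<noteq> bot \<and> U \<le> principal S \<and> (\<forall>P. eventually P U \<or> eventually (\<lambda>x. \<not> P x) U)}"

definition SC_top :: "'a set \<Rightarrow> 'a filter topology" where
  "SC_top S =
     topology_generated_by {{U \<in> ultrafilters_on S. eventually (\<lambda>x. x \<in> B) U} | B. B \<subseteq> S}"

abbreviation SC_basic :: "'a set \<Rightarrow> 'a set \<Rightarrow> 'a filter set" where
  "SC_basic S B \<equiv> {U \<in> ultrafilters_on S. eventually (\<lambda>x. x \<in> B) U}"

lemma ultrafilters_on_mem: "U \<in> ultrafilters_on S \<Longrightarrow> eventually (\<lambda>x. x \<in> S) U"
  by (auto simp: ultrafilters_on_def le_principal)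

lemma ultrafilters_on_not:
  assumes "U \<in> ultrafilters_on S"
  shows "eventually (\<lambda>x. \<not> P x) U \<longleftrightarrow> \<not> eventually P U"
proof -
  have "False" if "eventually (\<lambda>x. \<not> P x) U" "eventually P U"
  proof -
    have "eventually (\<lambda>x. False) U"
      using eventually_conj[OF that] by simp
    then show False
      using assms by (simp add: ultrafilters_on_def trivial_limit_def)
  qed
  then show ?thesis
    using assms by (auto simp: ultrafilters_on_def)
qed

lemma principal_in_ultrafilters_on: "s \<in> S \<Longrightarrow> principal {s} \<in> ultrafilters_on S"
  by (auto simp: ultrafilters_on_def eventually_principal principal_eq_bot_iff)

lemma topspace_SC_top [simp]: "topspace (SC_top S) = ultrafilters_on S"
proof -
  have "ultrafilters_on S = SC_basic S S"
    by (auto dest: ultrafilters_on_mem)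
  then show ?thesis
    unfolding SC_top_def topology_generated_by_topspace by blast
qed

lemma openin_SC_basic: "B \<subseteq> S \<Longrightarrow> openin (SC_top S) (SC_basic S B)"
  unfolding SC_top_def by (rule topology_generated_by_Basis) auto

lemma openin_SC_top_basis:
  assumes "openin (SC_top S) W" "U \<in> W"
  obtains B where "B \<subseteq> S" "U \<in> SC_basic S B" "SC_basic S B \<subseteq> W"
proof -
  have "generate_topology_on {SC_basic S B | B. B \<subseteq> S} W"
    using assms(1) unfolding SC_top_def by (rule openin_topology_generated_by)
  then have "\<forall>U\<in>W. \<exists>B\<subseteq>S. U \<in> SC_basic S B \<and> SC_basic S B \<subseteq> W"
  proof induction
    case (Int a b)
    show ?case
    proof
      fix U assume "U \<in> a \<inter> b"
      then obtain B C where "B \<subseteq> S" "U \<in> SC_basic S B" "SC_basic S B \<subseteq> a"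
        "C \<subseteq> S" "U \<in> SC_basic S C" "SC_basic S C \<subseteq> b"
        using Int by (meson IntD1 IntD2)
      then have "U \<in> SC_basic S (B \<inter> C) \<and> SC_basic S (B \<inter> C) \<subseteq> a \<inter> b"
        by (auto simp: eventually_conj_iff)
      then show "\<exists>B\<subseteq>S. U \<in> SC_basic S B \<and> SC_basic S B \<subseteq> a \<inter> b"
        using \<open>B \<subseteq> S\<close> by blast
    qed
  next
    case (UN K)
    show ?case
    proof
      fix U assume "U \<in> \<Union>K"
      then obtain k where k: "k \<in> K" "U \<in> k" by blast
      then obtain B where "B \<subseteq> S" "U \<in> SC_basic S B" "SC_basic S B \<subseteq> k"
        using UN by meson
      then show "\<exists>B\<subseteq>S. U \<in> SC_basic S B \<and> SC_basic S B \<subseteq> \<Union>K"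
        using k by blast
    qed
  qed auto
  then show ?thesis
    using assms(2) that by meson
qed

lemma ultrafilter_below:
  assumes "F \<noteq> bot" "F \<le> principal S"
  obtains U where "U \<in> ultrafilters_on S" "U \<le> F"
proof -
  define r where "r = {(a, b :: 'a filter). a \<noteq> bot \<and> b \<noteq> bot \<and> a \<le> F \<and> b \<le> F \<and> b \<le> a}"
  have Field: "Field r = {a. a \<noteq> bot \<and> a \<le> F}"
    by (auto simp: r_def Field_def)
  have po: "Partial_order r"
    unfolding partial_order_on_def preorder_on_def Field
    by (auto simp: r_def refl_on_def trans_def antisym_def)
  have "\<exists>m\<in>Field r. \<forall>a\<in>Field r. (m, a) \<in> r \<longrightarrow> a = m"
  proof (rule Zorns_po_lemma[OF po])
    fix C assume C: "C \<in> Chains r"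
    show "\<exists>u\<in>Field r. \<forall>a\<in>C. (a, u) \<in> r"
    proof (cases "C = {}")
      case True
      then show ?thesis using assms(1) Field by auto
    next
      case False
      have CF: "a \<noteq> bot" "a \<le> F" if "a \<in> C" for a
        using C that unfolding Chains_def r_def by blast+
      have "eventually P (Inf C) \<longleftrightarrow> (\<exists>b\<in>C. eventually P b)" for P
      proof (rule eventually_Inf_base[OF False])
        fix a b assume "a \<in> C" "b \<in> C"
        then have "a \<le> b \<or> b \<le> a"
          using C unfolding Chains_def r_def by blast
        then show "\<exists>x\<in>C. x \<le> inf a b"
          using \<open>a \<in> C\<close> \<open>b \<in> C\<close> by (metis inf.absorb1 inf.absorb2 order_refl)
      qed
      then have "Inf C \<noteq> bot"
        using CF(1) by (metis trivial_limit_def)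
      moreover have "Inf C \<le> F"
        using False CF(2) by (meson Inf_lower2 ex_in_conv)
      ultimately show ?thesis
        using CF unfolding Field by (intro bexI[of _ "Inf C"]) (auto simp: r_def Inf_lower)
    qed
  qed
  then obtain m where m: "m \<noteq> bot" "m \<le> F"
    and max: "\<And>a. a \<noteq> bot \<Longrightarrow> a \<le> m \<Longrightarrow> a = m"
    unfolding Field by (auto simp: r_def)
  have "eventually P m \<or> eventually (\<lambda>x. \<not> P x) m" for P
  proof (rule disjCI)
    assume nP: "\<not> eventually (\<lambda>x. \<not> P x) m"
    have "inf m (principal {x. P x}) \<noteq> bot"
      using nP by (simp add: trivial_limit_def eventually_inf_principal)
    then have "inf m (principal {x. P x}) = m"
      by (intro max) auto
    then show "eventually P m"
      by (metis inf.orderI le_principal mem_Collect_eq eventually_mono)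
  qed
  then have "m \<in> ultrafilters_on S"
    using m assms(2) by (auto simp: ultrafilters_on_def)
  then show ?thesis
    using m(2) that by blast
qed

lemma compact_space_SC_top: "compact_space (SC_top S)"
  unfolding compact_space_alt
proof (intro allI impI, elim conjE)
  fix \<C> assume op: "\<forall>W\<in>\<C>. openin (SC_top S) W" and cov: "topspace (SC_top S) \<subseteq> \<Union>\<C>"
  define \<B> where "\<B> = {B. B \<subseteq> S \<and> (\<exists>W\<in>\<C>. SC_basic S B \<subseteq> W)}"
  define F where "F = inf (INF B\<in>\<B>. principal (S - B)) (principal S)"
  have "F = bot"
  proof (rule ccontr)
    assume "F \<noteq> bot"
    moreover have "F \<le> principal S" by (simp add: F_def)
    ultimately obtain U where U: "U \<in> ultrafilters_on S" "U \<le> F"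
      by (rule ultrafilter_below)
    then obtain W where "W \<in> \<C>" "U \<in> W" using cov by auto
    from \<open>W \<in> \<C>\<close> have "openin (SC_top S) W" using op by blast
    then obtain B where B: "B \<subseteq> S" "U \<in> SC_basic S B" "SC_basic S B \<subseteq> W"
      using \<open>U \<in> W\<close> by (rule openin_SC_top_basis)
    then have "B \<in> \<B>" using \<open>W \<in> \<C>\<close> by (auto simp: \<B>_def)
    then have "F \<le> principal (S - B)"
      unfolding F_def by (meson INF_lower inf.coboundedI1)
    then have "eventually (\<lambda>x. x \<in> S - B) U"
      using U(2) by (metis le_principal order_trans)
    then have "eventually (\<lambda>x. x \<notin> B) U"
      by (rule eventually_mono) auto
    then show False
      using B(2) U(1) ultrafilters_on_not[OF U(1), of "\<lambda>x. x \<in> B"] by auto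
  qed
  then have "eventually (\<lambda>x. x \<notin> S) (INF B\<in>\<B>. principal (S - B))"
    by (simp add: F_def trivial_limit_def eventually_inf_principal)
  then obtain X where X: "X \<subseteq> \<B>" "finite X"
    "eventually (\<lambda>x. x \<notin> S) (INF B\<in>X. principal (S - B))"
    by (metis eventually_INF)
  then have "S \<subseteq> \<Union>X"
    by (auto simp: INF_principal_finite eventually_principal split: if_splits)
  have "\<forall>B\<in>X. \<exists>W. W \<in> \<C> \<and> SC_basic S B \<subseteq> W"
    using X(1) by (auto simp: \<B>_def)
  then obtain w where w: "\<And>B. B \<in> X \<Longrightarrow> w B \<in> \<C> \<and> SC_basic S B \<subseteq> w B"
    unfolding bchoice_iff by blast
  have "topspace (SC_top S) \<subseteq> \<Union>(w ` X)"
  proof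
    fix U assume "U \<in> topspace (SC_top S)"
    then have U: "U \<in> ultrafilters_on S" by simp
    have "\<exists>B\<in>X. eventually (\<lambda>x. x \<in> B) U"
    proof (rule ccontr)
      assume "\<not> ?thesis"
      then have "\<forall>B\<in>X. eventually (\<lambda>x. x \<notin> B) U"
        using ultrafilters_on_not[OF U] by blast
      then have "eventually (\<lambda>x. \<forall>B\<in>X. x \<notin> B) U"
        using X(2) by (simp add: eventually_ball_finite_distrib)
      then have "eventually (\<lambda>x. x \<notin> S) U"
        by (rule eventually_mono) (use \<open>S \<subseteq> \<Union>X\<close> in auto)
      then show False
        using ultrafilters_on_not[OF U, of "\<lambda>x. x \<in> S"] ultrafilters_on_mem[OF U] by auto
    qed
    then show "U \<in> \<Union>(w ` X)"
      using w U by fastforce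
  qed
  then show "\<exists>\<F>. finite \<F> \<and> \<F> \<subseteq> \<C> \<and> topspace (SC_top S) \<subseteq> \<Union>\<F>"
    using X(2) w by (intro exI[of _ "w ` X"]) auto
qed

lemma Hausdorff_space_SC_top: "Hausdorff_space (SC_top S)"
  unfolding Hausdorff_space_def
proof (intro allI impI)
  fix U V assume *: "U \<in> topspace (SC_top S) \<and> V \<in> topspace (SC_top S) \<and> U \<noteq> V"
  then have UV: "U \<in> ultrafilters_on S" "V \<in> ultrafilters_on S" by auto
  obtain P where P: "eventually P U" "eventually (\<lambda>x. \<not> P x) V"
  proof -
    obtain P where "eventually P U \<noteq> eventually P V"
      using * by (auto simp: filter_eq_iff)
    then show ?thesis
      using that[of P] that[of "\<lambda>x. \<not> P x"] ultrafilters_on_not[OF UV(1)] ultrafilters_on_not[OF UV(2)]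
      by (cases "eventually P U") auto
  qed
  define B where "B = {x \<in> S. P x}"
  have "U \<in> SC_basic S B"
    using UV P ultrafilters_on_mem by (auto simp: B_def eventually_conj_iff)
  moreover have "V \<in> SC_basic S (S - B)"
    using UV P ultrafilters_on_mem[OF UV(2)]
    by (auto simp: B_def elim: eventually_elim2)
  moreover have "disjnt (SC_basic S B) (SC_basic S (S - B))"
    by (auto simp: disjnt_def eventually_conj_iff dest: ultrafilters_on_not)
  moreover have "openin (SC_top S) (SC_basic S B)" "openin (SC_top S) (SC_basic S (S - B))"
    by (rule openin_SC_basic, force simp: B_def)+
  ultimately show "\<exists>W W'. openin (SC_top S) W \<and> openin (SC_top S) W' \<and> U \<in> W \<and> V \<in> W' \<and> disjnt W W'"
    by blast
qed

lemma SC_top_dense: "SC_top S closure_of ((\<lambda>s. principal {s}) ` S) = topspace (SC_top S)"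
proof -
  have "\<exists>s\<in>S. principal {s} \<in> W" if W: "openin (SC_top S) W" "U \<in> W" for U W
  proof -
    obtain B where B: "B \<subseteq> S" "U \<in> SC_basic S B" "SC_basic S B \<subseteq> W"
        by (rule openin_SC_top_basis[OF W])
    then have "B \<noteq> {}"
      by (auto simp: ultrafilters_on_def trivial_limit_def)
    then obtain s where "s \<in> B" by blast
    then show ?thesis
      using B principal_in_ultrafilters_on[of s S]
      by (intro bexI[of _ s] subsetD[OF B(3)]) (auto simp: eventually_principal)
  qed
  then show ?thesis
    by (auto simp: closure_of_def)
qed

lemma SC_top_discrete:
  assumes "s \<in> S"
  shows "openin (SC_top S) {principal {s}}"
proof -
  have "SC_basic S {s} = {principal {s}}"
  proof -
    have "U = principal {s}" if "U \<in> ultrafilters_on S" "eventually (\<lambda>x. x \<in> {s}) U" for U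
    proof -
      have le: "U \<le> principal {s}" using that(2) by (simp add: le_principal)
      have "P s" if P: "eventually P U" for P
      proof (rule ccontr)
        assume "\<not> P s"
        then have "eventually (\<lambda>x. \<not> P x) U"
          using \<open>eventually (\<lambda>x. x \<in> {s}) U\<close> by (auto elim!: eventually_mono)
        then show False
          using P ultrafilters_on_not[OF \<open>U \<in> ultrafilters_on S\<close>, of P] by simp
      qed
      then show ?thesis
        using le by (intro antisym) (auto simp: le_filter_def eventually_principal)
    qed
    moreover have "principal {s} \<in> SC_basic S {s}"
      using principal_in_ultrafilters_on[OF assms] by (simp add: eventually_principal)
    ultimately show ?thesis by blast
  qed
  then show ?thesis
    using openin_SC_basic[of "{s}" S] assms by simp
qed

lemma SC_top_extension:
  assumes K: "compact_space K" "Hausdorff_space K" and f: "f \<in> S \<rightarrow> topspace K"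
  obtains h where "continuous_map (SC_top S) K h" "\<And>s. s \<in> S \<Longrightarrow> h (principal {s}) = f s"
proof -
  have ex: "\<exists>l. limitin K f l U" if U: "U \<in> ultrafilters_on S" for U
  proof (rule ccontr)
    assume no: "\<not> ?thesis"
    define \<V> where "\<V> = {V. openin K V \<and> \<not> eventually (\<lambda>x. f x \<in> V) U}"
    have "topspace K \<subseteq> \<Union>\<V>"
      using no unfolding limitin_def \<V>_def by blast
    moreover have "\<forall>V\<in>\<V>. openin K V"
      by (simp add: \<V>_def)
    ultimately obtain \<F> where \<F>: "finite \<F>" "\<F> \<subseteq> \<V>" "topspace K \<subseteq> \<Union>\<F>"
      using K(1) unfolding compact_space_alt by meson
    have "\<forall>V\<in>\<F>. eventually (\<lambda>x. f x \<notin> V) U"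
      using \<F>(2) ultrafilters_on_not[OF U] unfolding \<V>_def by blast
    then have "eventually (\<lambda>x. \<forall>V\<in>\<F>. f x \<notin> V) U"
      using \<F>(1) by (simp add: eventually_ball_finite_distrib)
    then have "eventually (\<lambda>x. x \<notin> S) U"
      by (rule eventually_mono) (use \<F>(3) f in fastforce)
    then show False
      using ultrafilters_on_not[OF U, of "\<lambda>x. x \<in> S"] ultrafilters_on_mem[OF U] by auto
  qed
  define h where "h U = (SOME l. limitin K f l U)" for U
  have h: "limitin K f (h U) U" if "U \<in> ultrafilters_on S" for U
    unfolding h_def using ex[OF that] by (rule someI_ex)
  show ?thesis
  proof (rule that[of h])
    show "h (principal {s}) = f s" if "s \<in> S" for s
    proof (rule limitin_Hausdorff_unique[where f = f and F = "principal {s}" and X = K])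
      show "limitin K f (h (principal {s})) (principal {s})"
        by (rule h[OF principal_in_ultrafilters_on[OF that]])
      show "limitin K f (f s) (principal {s})"
        using f that by (auto simp: limitin_def eventually_principal)
      show "principal {s} \<noteq> bot"
        by (simp add: principal_eq_bot_iff)
    qed (rule K(2))
    have "\<exists>V. openin (SC_top S) V \<and> U \<in> V \<and> (\<forall>U'\<in>V. h U' \<in> W)"
      if U: "U \<in> ultrafilters_on S" and W: "openin K W" "h U \<in> W" for U W
    proof -
      obtain V C where VC: "openin K V" "closedin K C" "h U \<in> V" "V \<subseteq> C" "C \<subseteq> W"
        using compact_Hausdorff_imp_regular_space[OF K] W
        unfolding neighbourhood_base_of_closedin[symmetric] neighbourhood_base_of by metis
      define B where "B = {s \<in> S. f s \<in> V}"
      have "U \<in> SC_basic S B"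
        using limitinD[OF h[OF U] VC(1,3)] ultrafilters_on_mem[OF U] U
        by (auto simp: B_def eventually_conj_iff)
      moreover have "h U' \<in> W" if "U' \<in> SC_basic S B" for U'
      proof -
        have "h U' \<in> C"
        proof (rule limitin_closedin[OF _ VC(2)])
          show "limitin K f (h U') U'" using h that by blast
          show "eventually (\<lambda>x. f x \<in> C) U'"
            using that VC(4) by (auto simp: B_def elim!: eventually_mono)
          show "U' \<noteq> bot"
            using that by (auto simp: ultrafilters_on_def)
        qed
        then show ?thesis using VC by blast
      qed
      ultimately show ?thesis
        using openin_SC_basic[of B S] by (intro exI[of _ "SC_basic S B"]) (auto simp: B_def)
    qed
    moreover have "h U \<in> topspace K" if "U \<in> ultrafilters_on S" for U
      using h[OF that] by (rule limitin_topspace)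
    ultimately show "continuous_map (SC_top S) K h"
      unfolding continuous_map_eq_topcontinuous_at topcontinuous_at_def by simp
  qed
qed

abbreviation SC_group :: "('g, 'm) monoid_scheme \<Rightarrow> 'g filter topology" where
  "SC_group G \<equiv> SC_top (carrier G)"

definition SC_action :: "('g, 'm) monoid_scheme \<Rightarrow> 'g \<Rightarrow> 'g filter \<Rightarrow> 'g filter" where
  "SC_action G g = restrict (filtermap (\<lambda>x. g \<otimes>\<^bsub>G\<^esub> x)) (topspace (SC_group G))"

definition SC_closure :: "('g, 'm) monoid_scheme \<Rightarrow> 'g set \<Rightarrow> 'g filter set" where
  "SC_closure G B = SC_group G closure_of ((\<lambda>x. principal {x}) ` B)"

definition SC_subspace :: "('g, 'm) monoid_scheme \<Rightarrow> 'g set \<Rightarrow> 'g filter set" where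
  "SC_subspace G A = (\<Union>g\<in>carrier G. SC_closure G (g <#\<^bsub>G\<^esub> A))"

lemma SC_action_in_ultrafilters_on:
  assumes "group G" "g \<in> carrier G" "U \<in> ultrafilters_on (carrier G)"
  shows "SC_action G g U \<in> ultrafilters_on (carrier G)"
proof -
  interpret group G by fact
  have "eventually (\<lambda>x. g \<otimes>\<^bsub>G\<^esub> x \<in> carrier G) U"
    using ultrafilters_on_mem[OF assms(3)] by (rule eventually_mono) (use assms(2) in auto)
  then show ?thesis
    using assms(3)
    by (auto simp: SC_action_def ultrafilters_on_def le_principal eventually_filtermap filtermap_bot_iff)
qed

lemma SC_action_principal:
  "s \<in> carrier G \<Longrightarrow> SC_action G g (principal {s}) = principal {g \<otimes>\<^bsub>G\<^esub> s}"
  by (simp add: SC_action_def principal_in_ultrafilters_on)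

lemma SC_action_mult:
  assumes "group G" "g \<in> carrier G" "h \<in> carrier G" "U \<in> ultrafilters_on (carrier G)"
  shows "SC_action G (g \<otimes>\<^bsub>G\<^esub> h) U = SC_action G g (SC_action G h U)"
proof -
  interpret group G by fact
  have "filtermap (\<lambda>x. g \<otimes>\<^bsub>G\<^esub> h \<otimes>\<^bsub>G\<^esub> x) U = filtermap (\<lambda>x. g \<otimes>\<^bsub>G\<^esub> (h \<otimes>\<^bsub>G\<^esub> x)) U"
    unfolding filter_eq_iff eventually_filtermap
  proof
    fix P
    show "eventually (\<lambda>x. P (g \<otimes>\<^bsub>G\<^esub> h \<otimes>\<^bsub>G\<^esub> x)) U = eventually (\<lambda>x. P (g \<otimes>\<^bsub>G\<^esub> (h \<otimes>\<^bsub>G\<^esub> x))) U"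
      by (rule eventually_cong[OF ultrafilters_on_mem[OF assms(4)]]) (use assms in \<open>simp add: m_assoc\<close>)
  qed
  then show ?thesis
    using SC_action_in_ultrafilters_on[OF assms(1,3,4)] assms(4)
    by (simp add: SC_action_def filtermap_filtermap)
qed

lemma SC_action_one:
  assumes "group G" "U \<in> ultrafilters_on (carrier G)"
  shows "SC_action G \<one>\<^bsub>G\<^esub> U = U"
proof -
  interpret group G by fact
  have "filtermap (\<lambda>x. \<one>\<^bsub>G\<^esub> \<otimes>\<^bsub>G\<^esub> x) U = U"
    unfolding filter_eq_iff eventually_filtermap
  proof
    fix P
    show "eventually (\<lambda>x. P (\<one>\<^bsub>G\<^esub> \<otimes>\<^bsub>G\<^esub> x)) U = eventually P U"
      by (rule eventually_cong[OF ultrafilters_on_mem[OF assms(2)]]) simp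
  qed
  then show ?thesis
    using assms(2) by (simp add: SC_action_def)
qed

lemma continuous_map_SC_action:
  assumes "group G" "g \<in> carrier G"
  shows "continuous_map (SC_group G) (SC_group G) (SC_action G g)"
proof -
  interpret group G by fact
  note act = SC_action_in_ultrafilters_on[OF assms]
  have ev: "eventually P (SC_action G g U) \<longleftrightarrow> eventually (\<lambda>x. P (g \<otimes>\<^bsub>G\<^esub> x)) U"
    if "U \<in> ultrafilters_on (carrier G)" for P U
    using that by (simp add: SC_action_def eventually_filtermap)
  have "\<exists>V. openin (SC_group G) V \<and> U \<in> V \<and> (\<forall>U'\<in>V. SC_action G g U' \<in> W)"
    if U: "U \<in> ultrafilters_on (carrier G)" and W: "openin (SC_group G) W" "SC_action G g U \<in> W" for U W
  proof -
    obtain B where B: "B \<subseteq> carrier G" "SC_action G g U \<in> SC_basic (carrier G) B" "SC_basic (carrier G) B \<subseteq> W"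
      using W by (rule openin_SC_top_basis)
    define D where "D = {x \<in> carrier G. g \<otimes>\<^bsub>G\<^esub> x \<in> B}"
    have "U \<in> SC_basic (carrier G) D"
      using B(2) ev[OF U] U ultrafilters_on_mem[OF U] by (simp add: D_def eventually_conj_iff)
    moreover have "SC_action G g U' \<in> W" if "U' \<in> SC_basic (carrier G) D" for U'
    proof (rule subsetD[OF B(3)])
      show "SC_action G g U' \<in> SC_basic (carrier G) B"
        using that ev[of U'] act[of U'] by (simp add: D_def eventually_conj_iff)
    qed
    moreover have "openin (SC_group G) (SC_basic (carrier G) D)"
      by (rule openin_SC_basic) (auto simp: D_def)
    ultimately show ?thesis by blast
  qed
  then show ?thesis
    unfolding continuous_map_eq_topcontinuous_at topcontinuous_at_def using act by simp
qed

lemma lc_gspace_SC: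
  assumes "group G"
  shows "lc_gspace G (SC_group G) (SC_action G)"
proof -
  interpret group G by fact
  note a = SC_action_in_ultrafilters_on[OF assms] SC_action_mult[OF assms] SC_action_one[OF assms]
  have inv: "SC_action G (inv\<^bsub>G\<^esub> g) (SC_action G g U) = U" "SC_action G g (SC_action G (inv\<^bsub>G\<^esub> g) U) = U"
    if "g \<in> carrier G" "U \<in> ultrafilters_on (carrier G)" for g U
    using that a(2)[of "inv\<^bsub>G\<^esub> g" g U] a(2)[of g "inv\<^bsub>G\<^esub> g" U] a(3)[of U] by auto
  have Bij: "SC_action G g \<in> Bij (ultrafilters_on (carrier G))" if "g \<in> carrier G" for g
  proof -
    have "bij_betw (SC_action G g) (ultrafilters_on (carrier G)) (ultrafilters_on (carrier G))"
      by (rule bij_betwI[where g = "SC_action G (inv\<^bsub>G\<^esub> g)"]) (use that inv a(1) in auto)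
    then show ?thesis
      by (auto simp: Bij_def SC_action_def)
  qed
  have "SC_action G (g \<otimes>\<^bsub>G\<^esub> h) =
      compose (ultrafilters_on (carrier G)) (SC_action G g) (SC_action G h)"
    if "g \<in> carrier G" "h \<in> carrier G" for g h
    using a(2)[OF that] by (intro extensionalityI[where A = "ultrafilters_on (carrier G)"])
      (auto simp: compose_def SC_action_def)
  then have "SC_action G \<in> hom G (BijGroup (ultrafilters_on (carrier G)))"
    using Bij by (auto simp: hom_def BijGroup_def)
  then have "group_action G (topspace (SC_group G)) (SC_action G)"
    by (simp add: group_action_def group_hom_def group_hom_axioms_def group_BijGroup assms)
  moreover have "homeomorphic_map (SC_group G) (SC_group G) (SC_action G g)" if "g \<in> carrier G" for g
    unfolding homeomorphic_map_maps homeomorphic_maps_def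
    using continuous_map_SC_action[OF assms] that inv
    by (intro exI[of _ "SC_action G (inv\<^bsub>G\<^esub> g)"]) auto
  ultimately show ?thesis
    by (simp add: lc_gspace_def Hausdorff_space_SC_top compact_imp_locally_compact_space compact_space_SC_top)
qed

end

theory Submission
  imports Defs
begin

text \<open>
  Let \<open>(X, x0)\<close> be a pointed minimal space of type \<open>[A]\<close>.  The orbit map of \<open>x0\<close> extends to a continuous
  map \<open>h\<close> from the Stone-Cech compactification of \<open>G\<close> to the one-point compactification of \<open>X\<close>.  Since
  the subsets \<open>B\<close> of \<open>G\<close> with \<open>B.x0\<close> relatively compact are exactly those covered by finitely many
  translates of \<open>A\<close>, the preimage of \<open>X\<close> under \<open>h\<close> is exactly \<open>X_A\<close>.  Hence \<open>h\<close> restricts to a proper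
  map from \<open>X_A\<close> to \<open>X\<close>, and then to a proper map on the closed subset \<open>Z\<close>; its image is closed and
  invariant, so it is all of \<open>X\<close>.
\<close>

section \<open>Invariant subspaces\<close>

text \<open>\<open>invariant_set\<close> asks for one inclusion only; the other comes from applying
  it to the inverse of \<open>g\<close>.\<close>

lemma invariant_set_image_eq:
  assumes "group_action G E \<phi>" "invariant_set G \<phi> Z" "Z \<subseteq> E" "g \<in> carrier G"
  shows "\<phi> g ` Z = Z"
proof
  interpret group_action G E \<phi> by fact
  interpret G: group G using group_hom by (simp add: group_hom_def)
  show "\<phi> g ` Z \<subseteq> Z" using assms by (simp add: invariant_set_def)
  show "Z \<subseteq> \<phi> g ` Z"
  proof
    fix z assume z: "z \<in> Z"
    then have "\<phi> (inv\<^bsub>G\<^esub> g) z \<in> Z"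
      using assms(2,4) unfolding invariant_set_def by (meson G.inv_closed image_subset_iff)
    moreover have "z = \<phi> g (\<phi> (inv\<^bsub>G\<^esub> g) z)"
      using orbit_sym_aux[of "inv\<^bsub>G\<^esub> g" z] assms(3,4) z by auto
    ultimately show "z \<in> \<phi> g ` Z" by blast
  qed
qed

text \<open>Equality of images makes each restricted map onto \<open>Z\<close>. Being
  \<open>undefined\<close> off \<open>Z\<close>, as \<open>Bij Z\<close> demands, is the reason for
  \<open>restrict\<close> in \<open>restrict_action\<close>.\<close>

lemma group_action_restrict_action:
  assumes "group_action G E \<phi>" "invariant_set G \<phi> Z" "Z \<subseteq> E"
  shows "group_action G Z (restrict_action \<phi> Z)"
proof -
  interpret group_action G E \<phi> by fact
  interpret G: group G using group_hom by (simp add: group_hom_def)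
  note eq = invariant_set_image_eq[OF assms]
  have Bij: "restrict_action \<phi> Z g \<in> Bij Z" if "g \<in> carrier G" for g
    using eq[OF that] inj_on_subset[OF inj_prop[OF that] assms(3)]
    by (auto simp: Bij_def bij_betw_def restrict_action_def inj_on_restrict_eq)
  moreover have "restrict_action \<phi> Z (g \<otimes>\<^bsub>G\<^esub> h) =
      compose Z (restrict_action \<phi> Z g) (restrict_action \<phi> Z h)"
    if "g \<in> carrier G" "h \<in> carrier G" for g h
  proof
    fix x
    show "restrict_action \<phi> Z (g \<otimes>\<^bsub>G\<^esub> h) x =
        compose Z (restrict_action \<phi> Z g) (restrict_action \<phi> Z h) x"
      using eq[OF that(2)] composition_rule[of x g h] assms(3) that
      by (auto simp: compose_def restrict_action_def)
  qed
  ultimately have "restrict_action \<phi> Z \<in> hom G (BijGroup Z)"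
    by (auto simp: hom_def BijGroup_def)
  then show ?thesis
    by (simp add: group_action_def group_hom_def group_hom_axioms_def group_BijGroup G.is_group)
qed

text \<open>Local compactness passes to open and to closed subspaces. Both cases occur: X_A is
  treated as an open subspace, \<open>Z\<close> as a closed one.\<close>

lemma lc_gspace_restrict_action:
  assumes "lc_gspace G X \<phi>" "invariant_set G \<phi> Z" "openin X Z \<or> closedin X Z"
  shows "lc_gspace G (subtopology X Z) (restrict_action \<phi> Z)"
proof -
  have Z: "Z \<subseteq> topspace X" using assms(3) openin_subset closedin_subset by blast
  have act: "group_action G (topspace X) \<phi>" using assms(1) by (simp add: lc_gspace_def)
  have "homeomorphic_map (subtopology X Z) (subtopology X Z) (restrict_action \<phi> Z g)"
    if g: "g \<in> carrier G" for g
  proof -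
    have "homeomorphic_map (subtopology X Z) (subtopology X Z) (\<phi> g)"
      using assms(1) g invariant_set_image_eq[OF act assms(2) Z g] Z
      by (intro homeomorphic_map_subtopologies) (auto simp: lc_gspace_def Int_absorb1)
    then show ?thesis
      by (rule homeomorphic_map_eq) (simp add: restrict_action_def)
  qed
  moreover have "group_action G (topspace (subtopology X Z)) (restrict_action \<phi> Z)"
    using group_action_restrict_action[OF act assms(2) Z] Z by (simp add: Int_absorb1)
  moreover have "locally_compact_space (subtopology X Z)" "Hausdorff_space (subtopology X Z)"
    using assms locally_compact_space_open_subset locally_compact_space_closed_subset
    by (auto simp: lc_gspace_def Hausdorff_space_subtopology)
  ultimately show ?thesis by (simp add: lc_gspace_def)
qed

lemma restrict_action_restrict_action:
  "Z \<subseteq> W \<Longrightarrow> restrict_action (restrict_action \<phi> W) Z = restrict_action \<phi> Z"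
  by (auto simp: restrict_action_def fun_eq_iff)

text \<open>By continuity \<open>\<phi> g\<close> maps the closure of the orbit into the closure of
  its image, and that image stays in the orbit.\<close>

lemma invariant_set_closure_of_orbit:
  assumes "lc_gspace G X \<phi>" "x \<in> topspace X"
  shows "invariant_set G \<phi> (X closure_of (orbit G \<phi> x))"
  unfolding invariant_set_def
proof
  fix g assume g: "g \<in> carrier G"
  interpret group_action G "topspace X" \<phi> using assms(1) by (simp add: lc_gspace_def)
  interpret G: group G using group_hom by (simp add: group_hom_def)
  have "continuous_map X X (\<phi> g)"
    using assms(1) g by (simp add: lc_gspace_def homeomorphic_imp_continuous_map)
  then have "\<phi> g ` (X closure_of (orbit G \<phi> x)) \<subseteq> X closure_of (\<phi> g ` orbit G \<phi> x)"
    by (rule continuous_map_image_closure_subset)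
  also have "\<phi> g ` orbit G \<phi> x \<subseteq> orbit G \<phi> x"
    using g assms(2) by (fastforce simp: orbit_def simp flip: composition_rule)
  then have "X closure_of (\<phi> g ` orbit G \<phi> x) \<subseteq> X closure_of (orbit G \<phi> x)"
    by (rule closure_of_mono)
  finally show "\<phi> g ` (X closure_of (orbit G \<phi> x)) \<subseteq> X closure_of (orbit G \<phi> x)" .
qed

text \<open>The orbit closure of a point of \<open>Z\<close> is a non-empty closed invariant subset
  of \<open>Z\<close>, so minimality leaves only \<open>Z\<close> itself.\<close>

lemma minimal_lc_gspace_of_minimal_closed_invariant:
  assumes "lc_gspace G X \<phi>" "minimal_closed_invariant G X \<phi> Z"
  shows "minimal_lc_gspace G (subtopology X Z) (restrict_action \<phi> Z)"
proof -
  have Z: "closedin X Z" "Z \<noteq> {}" "invariant_set G \<phi> Z" "Z \<subseteq> topspace X"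
    using assms(2) closedin_subset by (auto simp: minimal_closed_invariant_def)
  interpret group_action G "topspace X" \<phi> using assms(1) by (simp add: lc_gspace_def)
  have "subtopology X Z closure_of orbit G (restrict_action \<phi> Z) x = Z" if x: "x \<in> Z" for x
  proof -
    let ?C = "X closure_of (orbit G \<phi> x)"
    have xX: "x \<in> topspace X" using x Z(4) by blast
    have orb: "orbit G \<phi> x \<subseteq> Z" using Z(3) x by (auto simp: orbit_def invariant_set_def)
    have "x \<in> ?C"
      using orbit_refl[OF xX] closure_of_subset[of "orbit G \<phi> x" X] orb Z(4) by blast
    moreover have "?C \<subseteq> Z" using orb Z(1) by (rule closure_of_minimal)
    ultimately have "?C = Z"
      using assms(2) invariant_set_closure_of_orbit[OF assms(1) xX] closedin_closure_of
      unfolding minimal_closed_invariant_def by blast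
    moreover have "orbit G (restrict_action \<phi> Z) x = orbit G \<phi> x"
      using x by (simp add: orbit_def restrict_action_def)
    \<comment> \<open>The orbit lies in \<open>Z\<close>, so its closure in the subspace is the
      trace on \<open>Z\<close> of its closure in \<open>X\<close>.\<close>
    ultimately show ?thesis using orb by (simp add: closure_of_subtopology_open)
  qed
  then show ?thesis
    using lc_gspace_restrict_action[OF assms(1) Z(3)] Z
    by (simp add: minimal_lc_gspace_def Int_absorb1)
qed

text \<open>\<open>C\<close> contains the orbit closure of each of its points, which is already
  everything. This later yields surjectivity.\<close>

lemma minimal_lc_gspace_closed_invariant_eq:
  assumes "minimal_lc_gspace G X \<phi>" "closedin X C" "invariant_set G \<phi> C" "C \<noteq> {}"
  shows "C = topspace X"
proof -
  obtain x where x: "x \<in> C" using assms(4) by blast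
  have C: "C \<subseteq> topspace X" using assms(2) closedin_subset by blast
  have "orbit G \<phi> x \<subseteq> C" using assms(3) x by (auto simp: orbit_def invariant_set_def)
  then have "X closure_of (orbit G \<phi> x) \<subseteq> C" using assms(2) by (rule closure_of_minimal)
  then show ?thesis using assms(1) x C unfolding minimal_lc_gspace_def by blast
qed


section \<open>The orbit map on the Stone-Cech compactification\<close>

lemma bounded_family_cong:
  assumes "group G" "A \<subseteq> carrier G" "B \<subseteq> carrier G" "set_equiv G A B"
  shows "bounded_family G A = bounded_family G B"
  using assms covered_by_trans unfolding bounded_family_def set_equiv_def by blast

text \<open>\<open>gspace_type\<close> is a definite description, so its value says something only
  through a set \<open>B\<close> realising it. Equal classes make \<open>B\<close> equivalent to
  \<open>A\<close>, and equivalent sets bound the same family.\<close>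

lemma relcompact_family_eq_bounded_family:
  assumes "group G" "A \<subseteq> carrier G" "A \<noteq> {}"
    and "pointed_lc_gspace G X \<phi> x0" "cocompact_gspace G X \<phi>"
    and "gspace_type G X \<phi> x0 = set_class G A"
  shows "relcompact_family G X \<phi> x0 = bounded_family G A"
proof -
  obtain B where B: "B \<subseteq> carrier G" "B \<noteq> {}" "relcompact_family G X \<phi> x0 = bounded_family G B"
    using assms(4,5) by (rule gspace_type_exists)
  have "set_class G B = set_class G A"
    using gspace_type_eqI[OF assms(1) B] assms(6) by simp
  moreover have "A \<in> set_class G A"
    using assms(1-3) covered_by_refl by (auto simp: set_class_def set_equiv_def)
  ultimately have "set_equiv G B A"
    by (auto simp: set_class_def)
  then show ?thesis
    using bounded_family_cong[OF assms(1) B(1) assms(2)] B(3) by simp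
qed

section \<open>Translates of \<open>A\<close> and the subspace X_A\<close>

lemma l_coset_in_bounded_family:
  assumes "group G" "A \<subseteq> carrier G" "g \<in> carrier G"
  shows "g <#\<^bsub>G\<^esub> A \<in> bounded_family G A"
proof -
  interpret group G by fact
  have "g <#\<^bsub>G\<^esub> A = {g} <#>\<^bsub>G\<^esub> A" by (auto simp: l_coset_def set_mult_def)
  then show ?thesis
    using assms l_coset_subset_G unfolding bounded_family_def covered_by_def by blast
qed

text \<open>This rests on the finiteness of the covering set \<open>F\<close>: closure commutes with
  the finite union of translates.\<close>

lemma SC_closure_subset_SC_subspace:
  assumes "B \<in> bounded_family G A"
  shows "SC_closure G B \<subseteq> SC_subspace G A"
proof -
  obtain F where F: "finite F" "F \<subseteq> carrier G" "B \<subseteq> F <#>\<^bsub>G\<^esub> A"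
    using assms by (auto simp: bounded_family_def covered_by_def)
  let ?p = "\<lambda>x. principal {x}"
  have "?p ` B \<subseteq> (\<Union>f\<in>F. ?p ` (f <#\<^bsub>G\<^esub> A))"
    using F(3) by (force simp: set_mult_def l_coset_def)
  then have "SC_closure G B \<subseteq> SC_group G closure_of (\<Union>f\<in>F. ?p ` (f <#\<^bsub>G\<^esub> A))"
    unfolding SC_closure_def by (rule closure_of_mono)
  also have "\<dots> = (\<Union>f\<in>F. SC_closure G (f <#\<^bsub>G\<^esub> A))"
    using F(1) by (simp add: closure_of_Union SC_closure_def)
  finally show ?thesis
    using F(2) by (auto simp: SC_subspace_def)
qed

text \<open>Translation by \<open>g\<close> is continuous and carries the principal ultrafilters
  over a translate of \<open>A\<close> to those over another translate, hence also the closure of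
  the former into that of the latter.\<close>

lemma invariant_set_SC_subspace:
  assumes "group G" "A \<subseteq> carrier G"
  shows "invariant_set G (SC_action G) (SC_subspace G A)"
proof -
  interpret group G by fact
  have "SC_action G g U \<in> SC_subspace G A"
    if g: "g \<in> carrier G" and f: "f \<in> carrier G" and U: "U \<in> SC_closure G (f <#\<^bsub>G\<^esub> A)" for g f U
  proof -
    have "SC_action G g U \<in>
        SC_group G closure_of (SC_action G g ` (\<lambda>x. principal {x}) ` (f <#\<^bsub>G\<^esub> A))"
      using continuous_map_image_closure_subset[OF continuous_map_SC_action[OF assms(1) g]] U
      unfolding SC_closure_def by blast
    also have "SC_action G g ` (\<lambda>x. principal {x}) ` (f <#\<^bsub>G\<^esub> A) =
        (\<lambda>x. principal {x}) ` (g <#\<^bsub>G\<^esub> (f <#\<^bsub>G\<^esub> A))"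
      using l_coset_subset_G[OF assms(2) f]
      by (force simp: l_coset_def SC_action_principal image_iff)
    also have "g <#\<^bsub>G\<^esub> (f <#\<^bsub>G\<^esub> A) = (g \<otimes>\<^bsub>G\<^esub> f) <#\<^bsub>G\<^esub> A"
      using assms(2) f g by (simp add: lcos_m_assoc)
    finally show ?thesis
      using f g by (auto simp: SC_subspace_def SC_closure_def)
  qed
  then show ?thesis
    by (auto simp: invariant_set_def SC_subspace_def)
qed

section \<open>Orbit maps and their restriction to X_A\<close>

text \<open>\<open>Some\<close> embeds \<open>X\<close>, and \<open>None\<close> is the point at
  infinity. On the closure of a translate of \<open>A\<close>, the values of \<open>h\<close> are
  limits inside a compact subset of \<open>X\<close>, so they avoid infinity. Conversely, if
  \<open>h U\<close> lies in \<open>X\<close>, the group elements moving \<open>x0\<close> into a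
  relatively compact open neighbourhood of that point form a set in
  \<open>bounded_family G A\<close> whose closure contains \<open>U\<close>.\<close>

lemma SC_orbit_map:
  assumes "group G" "A \<subseteq> carrier G" "lc_gspace G X \<phi>" "x0 \<in> topspace X"
    and fam: "relcompact_family G X \<phi> x0 = bounded_family G A"
  obtains h where "continuous_map (SC_group G) (Alexandroff_compactification X) h"
    "\<And>g. g \<in> carrier G \<Longrightarrow> h (principal {g}) = Some (\<phi> g x0)"
    "{U \<in> topspace (SC_group G). h U \<in> Some ` topspace X} = SC_subspace G A"
proof -
  let ?K = "Alexandroff_compactification X"
  let ?p = "\<lambda>x. principal {x}"
  have lc: "locally_compact_space X" "Hausdorff_space X" using assms(3) by (auto simp: lc_gspace_def)
  interpret group_action G "topspace X" \<phi> using assms(3) by (simp add: lc_gspace_def)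
  have orb: "\<phi> g x0 \<in> topspace X" if "g \<in> carrier G" for g
    using element_image[OF that assms(4)] by simp
  have "compact_space ?K" "Hausdorff_space ?K"
    using lc by (auto simp: Hausdorff_space_Alexandroff_compactification)
  moreover have "(\<lambda>g. Some (\<phi> g x0)) \<in> carrier G \<rightarrow> topspace ?K"
    using orb by auto
  ultimately obtain h where h: "continuous_map (SC_group G) ?K h"
    "\<And>g. g \<in> carrier G \<Longrightarrow> h (?p g) = Some (\<phi> g x0)"
    by (rule SC_top_extension[where S = "carrier G"]) blast
  have "h U \<in> Some ` topspace X" if U: "U \<in> SC_subspace G A" for U
  proof -
    obtain g where g: "g \<in> carrier G" "U \<in> SC_closure G (g <#\<^bsub>G\<^esub> A)"
      using U by (auto simp: SC_subspace_def)
    define B where "B = g <#\<^bsub>G\<^esub> A"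
    have "B \<in> relcompact_family G X \<phi> x0"
      unfolding B_def fam using assms(1,2) g(1) by (rule l_coset_in_bounded_family)
    then have B: "B \<subseteq> carrier G" "compactin X (X closure_of ((\<lambda>g. \<phi> g x0) ` B))"
      by (auto simp: relcompact_family_def)
    let ?C = "Some ` (X closure_of ((\<lambda>g. \<phi> g x0) ` B))"
    have "h U \<in> ?K closure_of (h ` ?p ` B)"
      using continuous_map_image_closure_subset[OF h(1)] g(2)
      unfolding SC_closure_def B_def by blast
    moreover have "?K closure_of (h ` ?p ` B) \<subseteq> ?C"
    proof (rule closure_of_minimal)
      have "(\<lambda>g. \<phi> g x0) ` B \<subseteq> X closure_of ((\<lambda>g. \<phi> g x0) ` B)"
        using orb B(1) by (intro closure_of_subset) blast
      then show "h ` ?p ` B \<subseteq> ?C"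
        using B(1) h(2) by auto
      \<comment> \<open>A compact closed subset of \<open>X\<close> stays closed in the
        compactification, so infinity is not among its limits.\<close>
      show "closedin ?K ?C"
        using B(2) by simp
    qed
    ultimately show ?thesis
      using closure_of_subset_topspace[of X "(\<lambda>g. \<phi> g x0) ` B"] by auto
  qed
  moreover have "U \<in> SC_subspace G A"
    if U: "U \<in> topspace (SC_group G)" "h U \<in> Some ` topspace X" for U
  proof -
    obtain x where x: "x \<in> topspace X" "h U = Some x" using U(2) by blast
    obtain V C where VC: "openin X V" "compactin X C" "x \<in> V" "V \<subseteq> C"
      using lc(1) x(1) unfolding locally_compact_space_def by meson
    define B where "B = {g \<in> carrier G. \<phi> g x0 \<in> V}"
    let ?W = "{U \<in> topspace (SC_group G). h U \<in> Some ` V}"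
    have "openin (SC_group G) ?W"
      using h(1) VC(1) by (intro openin_continuous_map_preimage) auto
    \<comment> \<open>Principal ultrafilters are dense, so each point of the open set
      \<open>?W\<close> is a limit of those lying in \<open>?W\<close>; these come from elements of
      \<open>B\<close>.\<close>
    then have "?W \<inter> SC_group G closure_of (?p ` carrier G)
        \<subseteq> SC_group G closure_of (?W \<inter> ?p ` carrier G)"
      by (rule openin_Int_closure_of_subset)
    moreover have "U \<in> ?W" using U(1) x VC(3) by auto
    moreover have "?W \<inter> ?p ` carrier G \<subseteq> ?p ` B"
      using h(2) by (auto simp: B_def)
    ultimately have "U \<in> SC_closure G B"
      using SC_top_dense[of "carrier G"] closure_of_mono[of "?W \<inter> ?p ` carrier G" "?p ` B" "SC_group G"]
      unfolding SC_closure_def by blast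
    moreover have "B \<in> bounded_family G A"
    proof -
      have "X closure_of ((\<lambda>g. \<phi> g x0) ` B) \<subseteq> C"
        using VC lc(2) by (intro closure_of_minimal compactin_imp_closedin) (auto simp: B_def)
      then have "compactin X (X closure_of ((\<lambda>g. \<phi> g x0) ` B))"
        using VC(2) closed_compactin closedin_closure_of by blast
      then show ?thesis
        unfolding fam[symmetric] by (auto simp: relcompact_family_def B_def)
    qed
    ultimately show ?thesis
      using SC_closure_subset_SC_subspace by blast
  qed
  moreover have "SC_subspace G A \<subseteq> topspace (SC_group G)"
    unfolding SC_subspace_def SC_closure_def by (intro UN_least closure_of_subset_topspace)
  ultimately have "{U \<in> topspace (SC_group G). h U \<in> Some ` topspace X} = SC_subspace G A"
    by blast
  then show ?thesis using h that by blast
qed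

text \<open>Every \<open>s\<close> lies in the translate of \<open>A\<close> by \<open>s\<close>
  times the inverse of an element \<open>a\<close> of \<open>A\<close>. Thus the copy of the group
  is a dense subset of X_A.\<close>

lemma principal_in_SC_subspace:
  assumes "group G" "A \<subseteq> carrier G" "A \<noteq> {}" "s \<in> carrier G"
  shows "principal {s} \<in> SC_subspace G A"
proof -
  interpret group G by fact
  obtain a where a: "a \<in> A" "a \<in> carrier G" using assms(2,3) by blast
  have "s = (s \<otimes>\<^bsub>G\<^esub> inv\<^bsub>G\<^esub> a) \<otimes>\<^bsub>G\<^esub> a" using a assms(4) by (simp add: m_assoc)
  then have s: "s \<in> (s \<otimes>\<^bsub>G\<^esub> inv\<^bsub>G\<^esub> a) <#\<^bsub>G\<^esub> A" using a(1) by (auto simp: l_coset_def)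
  have c: "s \<otimes>\<^bsub>G\<^esub> inv\<^bsub>G\<^esub> a \<in> carrier G" using a assms(4) by simp
  have "(\<lambda>x. principal {x}) ` ((s \<otimes>\<^bsub>G\<^esub> inv\<^bsub>G\<^esub> a) <#\<^bsub>G\<^esub> A)
      \<subseteq> SC_closure G ((s \<otimes>\<^bsub>G\<^esub> inv\<^bsub>G\<^esub> a) <#\<^bsub>G\<^esub> A)"
    unfolding SC_closure_def using l_coset_subset_G[OF assms(2) c]
    by (intro closure_of_subset) (auto intro: principal_in_ultrafilters_on)
  then show ?thesis using s c unfolding SC_subspace_def by blast
qed

text \<open>A space witnessing that \<open>A\<close> is of minimal type supplies an orbit map under
  which X_A is the preimage of the open part \<open>X\<close> of the compactification.\<close>

lemma openin_SC_subspace: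
  assumes "group G" "minimal_type TYPE('y) G A"
  shows "openin (SC_group G) (SC_subspace G A)"
proof -
  obtain X :: "'y topology" and \<phi> x0 where X: "minimal_lc_gspace G X \<phi>" "pointed_lc_gspace G X \<phi> x0"
      "gspace_type G X \<phi> x0 = set_class G A"
    and A: "A \<subseteq> carrier G" "A \<noteq> {}"
    using assms(2) unfolding minimal_type_def by blast
  have fam: "relcompact_family G X \<phi> x0 = bounded_family G A"
    by (rule relcompact_family_eq_bounded_family[OF assms(1) A X(2) minimal_lc_gspace_cocompact[OF X(1)] X(3)])
  have "lc_gspace G X \<phi>" "x0 \<in> topspace X"
    using X(2) by (auto simp: pointed_lc_gspace_def)
  then obtain h where h: "continuous_map (SC_group G) (Alexandroff_compactification X) h"
    "{U \<in> topspace (SC_group G). h U \<in> Some ` topspace X} = SC_subspace G A"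
    using SC_orbit_map[OF assms(1) A(1) _ _ fam] by metis
  have "openin (SC_group G) {U \<in> topspace (SC_group G). h U \<in> Some ` topspace X}"
    using h(1) by (rule openin_continuous_map_preimage) simp
  then show ?thesis using h(2) by simp
qed

text \<open>The map is \<open>h\<close> with \<open>Some\<close> removed. Equivariance is clear on
  principal ultrafilters and extends by density; properness comes from compactness of the whole
  space of ultrafilters.\<close>

lemma proper_gmap_SC_subspace:
  assumes "group G" "A \<subseteq> carrier G" "A \<noteq> {}" "lc_gspace G X \<phi>" "x0 \<in> topspace X"
    and "relcompact_family G X \<phi> x0 = bounded_family G A"
  obtains f where "proper_gmap G (subtopology (SC_group G) (SC_subspace G A))
    (restrict_action (SC_action G) (SC_subspace G A)) X \<phi> f"
proof -
  let ?K = "Alexandroff_compactification X"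
  let ?W = "SC_subspace G A"
  let ?S = "subtopology (SC_group G) ?W"
  let ?P = "(\<lambda>s. principal {s}) ` carrier G"
  obtain h where h: "continuous_map (SC_group G) ?K h"
    "\<And>g. g \<in> carrier G \<Longrightarrow> h (principal {g}) = Some (\<phi> g x0)"
    "{U \<in> topspace (SC_group G). h U \<in> Some ` topspace X} = ?W"
    by (rule SC_orbit_map[OF assms(1,2,4,5,6)]) blast
  interpret group_action G "topspace X" \<phi> using assms(4) by (simp add: lc_gspace_def)
  interpret G: group G by fact
  define f where "f U = the (h U)" for U
  have W: "?W \<subseteq> topspace (SC_group G)" using h(3) by blast
  then have topS [simp]: "topspace ?S = ?W" by auto
  have hf: "h U = Some (f U)" "f U \<in> topspace X" if "U \<in> ?W" for U
    using that unfolding h(3)[symmetric] f_def by auto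
  \<comment> \<open>A value of \<open>h\<close> in \<open>X\<close> already forces \<open>U\<close>
    into \<open>?W\<close>, so preimages under \<open>f\<close> are preimages under \<open>h\<close>
    in the whole compactification.\<close>
  have pre: "{U \<in> ?W. f U \<in> V} = {U \<in> topspace (SC_group G). h U \<in> Some ` V}"
    if "V \<subseteq> topspace X" for V
    using hf W h(3) that by fastforce
  have cont: "continuous_map ?S X f"
    unfolding continuous_map_def
  proof (intro conjI allI impI)
    show "f \<in> topspace ?S \<rightarrow> topspace X" using hf(2) by auto
    fix V assume V: "openin X V"
    have "openin (SC_group G) {U \<in> ?W. f U \<in> V}"
      unfolding pre[OF openin_subset[OF V]]
      using h(1) V by (intro openin_continuous_map_preimage) auto
    then show "openin ?S {U \<in> topspace ?S. f U \<in> V}"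
      by (auto simp: openin_subtopology)
  qed
  have act: "invariant_set G (SC_action G) ?W"
    using assms(1,2) by (rule invariant_set_SC_subspace)
  have "f (SC_action G g U) = \<phi> g (f U)" if g: "g \<in> carrier G" and U: "U \<in> ?W" for g U
  \<comment> \<open>Two continuous maps into a Hausdorff space that agree on the dense set
    \<open>?P\<close> agree at \<open>U\<close>.\<close>
  proof (rule forall_in_closure_of_eq[where X = ?S and Y = X and S = ?P and x = U])
    have "?P \<subseteq> ?W" using principal_in_SC_subspace[OF assms(1-3)] by blast
    then show "U \<in> ?S closure_of ?P"
      using SC_top_dense[of "carrier G"] U W by (auto simp: closure_of_subtopology_open)
    show "Hausdorff_space X" using assms(4) by (simp add: lc_gspace_def)
    have "continuous_map ?S ?S (SC_action G g)"
      using continuous_map_SC_action[OF assms(1) g] act g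
      by (auto simp: continuous_map_in_subtopology continuous_map_from_subtopology invariant_set_def)
    from continuous_map_compose[OF this cont]
    show "continuous_map ?S X (\<lambda>U. f (SC_action G g U))" by (simp add: o_def)
    have "continuous_map X X (\<phi> g)"
      using assms(4) g by (simp add: lc_gspace_def homeomorphic_imp_continuous_map)
    from continuous_map_compose[OF cont this]
    show "continuous_map ?S X (\<lambda>U. \<phi> g (f U))" by (simp add: o_def)
    show "f (SC_action G g V) = \<phi> g (f V)" if "V \<in> ?P" for V
      using that g h(2) composition_rule[OF assms(5) g]
      by (auto simp: SC_action_principal f_def)
  qed
  moreover have "compactin ?S {U \<in> topspace ?S. f U \<in> C}" if C: "compactin X C" for C
  proof -
    have "closedin ?K (Some ` C)"
      using C assms(4) by (simp add: lc_gspace_def compactin_imp_closedin)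
    then have "closedin (SC_group G) {U \<in> topspace (SC_group G). h U \<in> Some ` C}"
      using h(1) closedin_continuous_map_preimage by blast
    \<comment> \<open>Closedness in \<open>?W\<close> alone would not suffice in general; the
      preimage is closed in the compact space of all ultrafilters.\<close>
    then have "compactin (SC_group G) {U \<in> ?W. f U \<in> C}"
      unfolding pre[OF compactin_subset_topspace[OF C]]
      by (rule closedin_compact_space[OF compact_space_SC_top])
    then show ?thesis unfolding topS compactin_subtopology by blast
  qed
  ultimately have "proper_gmap G ?S (restrict_action (SC_action G) ?W) X \<phi> f"
    using cont by (simp add: proper_gmap_def restrict_action_def)
  then show ?thesis by (rule that)
qed

section \<open>Proper maps on closed subspaces and surjectivity\<close>

text \<open>Closedness of \<open>Z\<close> keeps the preimage of a compact set compact after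
  intersection with \<open>Z\<close>.\<close>

lemma proper_gmap_restrict_closed:
  assumes "proper_gmap G X \<phi> Y \<psi> f" "closedin X Z"
  shows "proper_gmap G (subtopology X Z) (restrict_action \<phi> Z) Y \<psi> f"
proof -
  have Z: "Z \<subseteq> topspace X" using assms(2) by (rule closedin_subset)
  have "compactin (subtopology X Z) {x \<in> topspace (subtopology X Z). f x \<in> K}"
    if "compactin Y K" for K
  proof -
    have "compactin X (Z \<inter> {x \<in> topspace X. f x \<in> K})"
      using assms that by (simp add: proper_gmap_def closed_Int_compactin)
    moreover have "Z \<inter> {x \<in> topspace X. f x \<in> K} = {x \<in> topspace (subtopology X Z). f x \<in> K}"
      by auto
    ultimately show ?thesis by (auto simp: compactin_subtopology)
  qed
  then show ?thesis
    using assms(1) Z by (auto simp: proper_gmap_def continuous_map_from_subtopology restrict_action_def)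
qed

text \<open>A proper map into a locally compact Hausdorff space is closed, so its image is a
  non-empty closed invariant subset of the minimal space \<open>Y\<close>.\<close>

lemma proper_gmap_onto_minimal:
  assumes "lc_gspace G X \<phi>" "topspace X \<noteq> {}" "minimal_lc_gspace G Y \<psi>" "proper_gmap G X \<phi> Y \<psi> f"
  shows "f ` topspace X = topspace Y"
proof (rule minimal_lc_gspace_closed_invariant_eq[OF assms(3)])
  interpret group_action G "topspace X" \<phi> using assms(1) by (simp add: lc_gspace_def)
  have f: "continuous_map X Y f" using assms(4) by (simp add: proper_gmap_def)
  have "locally_compact_space Y" "Hausdorff_space Y"
    using assms(3) by (auto simp: minimal_lc_gspace_def lc_gspace_def)
  \<comment> \<open>\<open>proper_map\<close> means closed with compact fibres. Compactness of
    preimages implies it because \<open>Y\<close> is a k-space whose compact subsets are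
    closed.\<close>
  then have "proper_map X Y f"
    using f assms(4) locally_compact_imp_k_space Hausdorff_imp_kc_space continuous_map_funspace[OF f]
    by (intro compact_imp_proper_map) (simp_all add: proper_gmap_def)
  then show "closedin Y (f ` topspace X)"
    using proper_imp_closed_map closed_map_def closedin_topspace by blast
  show "invariant_set G \<psi> (f ` topspace X)"
    unfolding invariant_set_def
  proof clarify
    fix g x assume "g \<in> carrier G" "x \<in> topspace X"
    then show "\<psi> g (f x) \<in> f ` topspace X"
      using assms(4) element_image[of g x] by (auto simp: proper_gmap_def intro!: image_eqI[of _ _ "\<phi> g x"])
  qed
qed (use assms(2) in simp)

theorem proposition6p5:
  fixes G :: "('g, 'm) monoid_scheme"
    and A :: "'g set"
    and Z :: "'g filter set"
  assumes "group G"
    and "minimal_type TYPE('y) G A"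
    and "minimal_closed_invariant G (subtopology (SC_group G) (SC_subspace G A))
           (restrict_action (SC_action G) (SC_subspace G A)) Z"
  shows "universal_minimal_gspace TYPE('x) G A
           (subtopology (SC_group G) Z) (restrict_action (SC_action G) Z)"
proof -
  let ?W = "SC_subspace G A"
  let ?S = "subtopology (SC_group G) ?W"
  let ?\<alpha> = "restrict_action (SC_action G) ?W"
  have A: "A \<subseteq> carrier G" "A \<noteq> {}" using assms(2) by (auto simp: minimal_type_def)
  have "lc_gspace G ?S ?\<alpha>"
    using lc_gspace_restrict_action[OF lc_gspace_SC[OF assms(1)]
        invariant_set_SC_subspace[OF assms(1) A(1)]] openin_SC_subspace[OF assms(1,2)] by blast
  then have "minimal_lc_gspace G (subtopology ?S Z) (restrict_action ?\<alpha> Z)"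
    using assms(3) by (rule minimal_lc_gspace_of_minimal_closed_invariant)
  moreover have clo: "closedin ?S Z" using assms(3) by (simp add: minimal_closed_invariant_def)
  then have "Z \<subseteq> ?W" using closedin_subset by fastforce
  \<comment> \<open>\<open>Z\<close> is given inside \<open>?S\<close>, while the conclusion views
    it inside the whole compactification; topology and action agree.\<close>
  then have eq: "subtopology ?S Z = subtopology (SC_group G) Z"
      "restrict_action ?\<alpha> Z = restrict_action (SC_action G) Z"
    by (simp_all add: subtopology_subtopology Int_absorb1 restrict_action_restrict_action)
  ultimately have min: "minimal_lc_gspace G (subtopology (SC_group G) Z) (restrict_action (SC_action G) Z)"
    by simp
  have "\<exists>f. proper_gmap G (subtopology (SC_group G) Z) (restrict_action (SC_action G) Z) X \<phi> f \<and>
      f ` topspace (subtopology (SC_group G) Z) = topspace X"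
    if X: "minimal_lc_gspace G X \<phi>" "pointed_lc_gspace G X \<phi> x0"
      "gspace_type G X \<phi> x0 = set_class G A"
    for X :: "'x topology" and \<phi> x0
  proof -
    have "relcompact_family G X \<phi> x0 = bounded_family G A"
      by (rule relcompact_family_eq_bounded_family[OF assms(1) A X(2) minimal_lc_gspace_cocompact[OF X(1)] X(3)])
    moreover have "lc_gspace G X \<phi>" "x0 \<in> topspace X"
      using X(2) by (auto simp: pointed_lc_gspace_def)
    ultimately obtain f where "proper_gmap G ?S ?\<alpha> X \<phi> f"
      using proper_gmap_SC_subspace[OF assms(1) A] by metis
    from proper_gmap_restrict_closed[OF this clo]
    have "proper_gmap G (subtopology (SC_group G) Z) (restrict_action (SC_action G) Z) X \<phi> f"
      by (simp add: eq)
    \<comment> \<open>Minimality of \<open>Z\<close> provides the non-empty locally compact source,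
      and minimality of \<open>X\<close> makes the map onto.\<close>
    then show ?thesis
      using proper_gmap_onto_minimal[OF _ _ X(1)] min unfolding minimal_lc_gspace_def by blast
  qed
  then show ?thesis
    using min unfolding universal_minimal_gspace_def by blast
qed

end
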